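(* Let $R$ be a complete valuation ring which is not a field, $K$ its field of fractions and $F$ its residue field. Then $$\mathbb{A}_R^1=Q^{\mathbb{A}}(\mathbb{A}_F^1)\cup\bigcup_{\omega\in[1,\infty)}J_\omega^{\mathbb{A}}(\mathbb{A}_{K^\omega}^1).$$
   Context: For a commutative unital Banach ring $(S,\|\cdot\|)$, $\mathbb{A}_S^1$ is the set of all non-zero multiplicative seminorms $\lambda$, written $\mathbf{p}\mapsto|\mathbf{p}|_\lambda$, on the polynomial ring $S[\mathbf{t}]$ whose restrictions to $S$ are contractive ($|a|_\lambda\le\|a\|$ for $a\in S$). A valuation ring is an integral domain $R$ with field of fractions $K$ such that for every non-zero $x\in K$, $x\in R$ or $x^{-1}\in R$. It is a complete valuation ring if the totally ordered group $K^\times/R^\times$ is isomorphic to an ordered subgroup of $\mathbb{R}$ and $R$ is complete under the induced norm; equivalently, $R=\{a\in K:|a|\le1\}$ for a complete non-Archimedean valued field $(K,|\cdot|)$. $R$ carries the norm $|\cdot|$. The residue field $F$ is equipped with the trivial norm. $\tilde Q:R[\mathbf{t}]\to F[\mathbf{t}]$ is the map induced by the quotient map $Q:R\to F$, and $Q^{\mathbb{A}}:\mathbb{A}_F^1\to\mathbb{A}_R^1$ is the injection $\mu\mapsto\mu\circ\tilde Q$. For $\omega\in[1,\infty)$, $K^\omega$ is the field $K$ equipped with the norm $|\cdot|^\omega$, and $J_\omega^{\mathbb{A}}:\mathbb{A}_{K^\omega}^1\to\mathbb{A}_R^1$ is the injection given by restriction of seminorms to $R[\mathbf{t}]$. *)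

theory Defs
  imports
    "HOL-Algebra.Coset"
    "HOL-Analysis.Abstract_Metric_Spaces"
    "HOL-Computational_Algebra.Polynomial_Factorial"
begin

section \<open>Valuation rings and their residue fields\<close>

text \<open>
  A class axiom cannot mention the type \<open>'a fract\<close>, so the condition on the fraction field is
  written in terms of the relation of which \<open>'a fract\<close> is the quotient: a non-zero
  element is \<open>a / b\<close>, and \<open>fractrel (a, b) (c, 1)\<close> says that it equals the ring element \<open>c\<close>.
  The usual form is recovered in \<open>valuation_ring_axiom_iff\<close> and \<open>fract_or_inverse\<close>.
\<close>

class valuation_ring = idom +
  assumes fractrel_or_inverse:
    "a \<noteq> 0 \<Longrightarrow> b \<noteq> 0 \<Longrightarrow> (\<exists>c. fractrel (a, b) (c, 1)) \<or> (\<exists>c. fractrel (b, a) (c, 1))"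

lemma valuation_ring_axiom_iff:
  "(\<forall>a b :: 'a :: idom. a \<noteq> 0 \<longrightarrow> b \<noteq> 0 \<longrightarrow>
      (\<exists>c. fractrel (a, b) (c, 1)) \<or> (\<exists>c. fractrel (b, a) (c, 1))) \<longleftrightarrow>
   (\<forall>x :: 'a fract. x \<noteq> 0 \<longrightarrow> x \<in> range to_fract \<or> inverse x \<in> range to_fract)"
  (is "?L \<longleftrightarrow> ?R")
proof -
  have mem: "Fract a b \<in> range to_fract \<longleftrightarrow> (\<exists>c. fractrel (a, b) (c, 1))" if "b \<noteq> 0" for a b :: 'a
  proof -
    have "Fract a b = to_fract c \<longleftrightarrow> fractrel (a, b) (c, 1)" for c
      using that by (simp add: to_fract_def eq_fract)
    then show ?thesis by (simp only: image_iff bex_UNIV)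
  qed
  have nz: "Fract a b \<noteq> 0 \<longleftrightarrow> a \<noteq> 0" if "b \<noteq> 0" for a b :: 'a
    using that by (simp add: Zero_fract_def eq_fract)
  show ?thesis
  proof
    assume L: ?L
    show ?R
    proof (intro allI impI)
      fix x :: "'a fract"
      assume x: "x \<noteq> 0"
      obtain a b where ab: "x = Fract a b" "b \<noteq> 0" by (cases x)
      with x nz[OF ab(2), of a] have "a \<noteq> 0" by simp
      from L[rule_format, OF this ab(2)]
      show "x \<in> range to_fract \<or> inverse x \<in> range to_fract"
        unfolding ab(1) inverse_fract mem[OF ab(2)] mem[OF \<open>a \<noteq> 0\<close>] .
    qed
  next
    assume R: ?R
    show ?L
    proof (intro allI impI)
      fix a b :: 'a
      assume a: "a \<noteq> 0" and b: "b \<noteq> 0"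
      from a nz[OF b, of a] have "Fract a b \<noteq> 0" by simp
      from R[rule_format, OF this]
      show "(\<exists>c. fractrel (a, b) (c, 1)) \<or> (\<exists>c. fractrel (b, a) (c, 1))"
        unfolding inverse_fract mem[OF b] mem[OF a] .
    qed
  qed
qed

lemma fract_or_inverse:
  fixes x :: "'a :: valuation_ring fract"
  assumes "x \<noteq> 0"
  shows "x \<in> range to_fract \<or> inverse x \<in> range to_fract"
proof -
  have "\<forall>a b :: 'a. a \<noteq> 0 \<longrightarrow> b \<noteq> 0 \<longrightarrow>
      (\<exists>c. fractrel (a, b) (c, 1)) \<or> (\<exists>c. fractrel (b, a) (c, 1))"
    by (intro allI impI fractrel_or_inverse)
  from this[unfolded valuation_ring_axiom_iff] assms show ?thesis by iprover
qed

lemma valuation_ring_dvd_total: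
  fixes a b :: "'a :: valuation_ring"
  shows "a dvd b \<or> b dvd a"
proof (cases "a = 0 \<or> b = 0")
  case False
  then have "Fract a b \<noteq> 0"
    by (simp add: Zero_fract_def eq_fract)
  from fract_or_inverse[OF this] show ?thesis
  proof
    assume "Fract a b \<in> range to_fract"
    then obtain c where "Fract a b = to_fract c" by blast
    with False have "a = c * b" by (simp add: to_fract_def eq_fract)
    then show ?thesis by simp
  next
    assume "inverse (Fract a b) \<in> range to_fract"
    then obtain c where "Fract b a = to_fract c" by auto
    with False have "b = c * a" by (simp add: to_fract_def eq_fract)
    then show ?thesis by simp
  qed
qed auto

lemma nonunit_add:
  fixes a b :: "'a :: valuation_ring"
  assumes "\<not> a dvd 1" "\<not> b dvd 1"
  shows "\<not> (a + b) dvd 1"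
  using valuation_ring_dvd_total[of a b]
proof
  assume "a dvd b"
  then have "a dvd a + b" by simp
  from dvd_trans[OF this, of 1] assms(1) show ?thesis by iprover
next
  assume "b dvd a"
  then have "b dvd a + b" by simp
  from dvd_trans[OF this, of 1] assms(2) show ?thesis by iprover
qed

lemma nonunit_mult:
  fixes a b :: "'a :: comm_ring_1"
  assumes "\<not> a dvd 1"
  shows "\<not> (c * a) dvd 1" "\<not> (a * c) dvd 1"
proof -
  show "\<not> (c * a) dvd 1"
  proof
    assume "(c * a) dvd 1"
    then have "a dvd 1" by (rule dvd_mult_right)
    with assms show False by contradiction
  qed
  show "\<not> (a * c) dvd 1"
  proof
    assume "(a * c) dvd 1"
    then have "a dvd 1" by (rule dvd_mult_left)
    with assms show False by contradiction
  qed
qed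

lemma nonunit_minus:
  fixes a :: "'a :: comm_ring_1"
  assumes "\<not> a dvd 1"
  shows "\<not> (- a) dvd 1"
  using assms by simp

text \<open>
  The maximal ideal of a valuation ring consists of its non-units, so two elements have the
  same residue class iff their difference is a non-unit.
\<close>

definition residue_rel :: "'a :: valuation_ring \<Rightarrow> 'a \<Rightarrow> bool" where
  "residue_rel a b \<longleftrightarrow> \<not> (a - b) dvd 1"

lemma equivp_residue_rel: "equivp (residue_rel :: 'a :: valuation_ring \<Rightarrow> 'a \<Rightarrow> bool)"
proof (rule equivpI)
  show "reflp (residue_rel :: 'a \<Rightarrow> 'a \<Rightarrow> bool)"
    by (simp add: reflp_def residue_rel_def)
  show "symp (residue_rel :: 'a \<Rightarrow> 'a \<Rightarrow> bool)"
  proof (rule sympI)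
    fix a b :: 'a
    assume "residue_rel a b"
    then show "residue_rel b a"
      using nonunit_minus[of "a - b"] by (simp add: residue_rel_def)
  qed
  show "transp (residue_rel :: 'a \<Rightarrow> 'a \<Rightarrow> bool)"
  proof (rule transpI)
    fix a b c :: 'a
    assume "residue_rel a b" "residue_rel b c"
    then show "residue_rel a c"
      using nonunit_add[of "a - b" "b - c"] by (simp add: residue_rel_def)
  qed
qed

quotient_type (overloaded) 'a residue_field = "'a :: valuation_ring" / residue_rel
  morphisms residue_rep to_residue
  by (rule equivp_residue_rel)

instantiation residue_field :: (valuation_ring) comm_ring_1
begin

lift_definition zero_residue_field :: "'a residue_field" is 0 .

lift_definition one_residue_field :: "'a residue_field" is 1 .

lift_definition plus_residue_field :: "'a residue_field \<Rightarrow> 'a residue_field \<Rightarrow> 'a residue_field"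
  is "(+)"
proof -
  fix a b c d :: 'a
  assume "residue_rel a b" "residue_rel c d"
  then show "residue_rel (a + c) (b + d)"
    using nonunit_add[of "a - b" "c - d"] by (simp add: residue_rel_def add_diff_add)
qed

lift_definition uminus_residue_field :: "'a residue_field \<Rightarrow> 'a residue_field" is uminus
proof -
  fix a b :: 'a
  assume "residue_rel a b"
  then have "\<not> (- (a - b)) dvd 1" unfolding residue_rel_def by (rule nonunit_minus)
  moreover have "- (a - b) = - a - - b" by simp
  ultimately show "residue_rel (- a) (- b)" by (simp only: residue_rel_def not_False_eq_True)
qed

lift_definition minus_residue_field :: "'a residue_field \<Rightarrow> 'a residue_field \<Rightarrow> 'a residue_field"
  is "(-)"
proof -
  fix a b c d :: 'a
  assume "residue_rel a b" "residue_rel c d"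
  then have "\<not> ((a - b) + - (c - d)) dvd 1"
    unfolding residue_rel_def by (intro nonunit_add nonunit_minus)
  moreover have "(a - b) + - (c - d) = (a - c) - (b - d)" by simp
  ultimately show "residue_rel (a - c) (b - d)" by (simp only: residue_rel_def not_False_eq_True)
qed

lift_definition times_residue_field :: "'a residue_field \<Rightarrow> 'a residue_field \<Rightarrow> 'a residue_field"
  is "(*)"
proof -
  fix a b c d :: 'a
  assume "residue_rel a b" "residue_rel c d"
  then have "\<not> ((a - b) * c + b * (c - d)) dvd 1"
    unfolding residue_rel_def by (intro nonunit_add nonunit_mult)
  moreover have "(a - b) * c + b * (c - d) = a * c - b * d" by (simp add: algebra_simps)
  ultimately show "residue_rel (a * c) (b * d)" by (simp only: residue_rel_def not_False_eq_True)
qed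

instance
proof
  fix a b c :: "'a residue_field"
  have eq: "residue_rel x y" if "x = y" for x y :: 'a
    using that by (simp add: residue_rel_def)
  show "a * b * c = a * (b * c)" by transfer (rule eq, rule mult.assoc)
  show "a * b = b * a" by transfer (rule eq, rule mult.commute)
  show "1 * a = a" by transfer (rule eq, simp)
  show "a + b + c = a + (b + c)" by transfer (rule eq, rule add.assoc)
  show "a + b = b + a" by transfer (rule eq, rule add.commute)
  show "0 + a = a" by transfer (rule eq, simp)
  show "- a + a = 0" by transfer (rule eq, simp)
  show "a - b = a + - b" by transfer (rule eq, simp)
  show "(a + b) * c = a * c + b * c" by transfer (rule eq, rule distrib_right)
  show "(0 :: 'a residue_field) \<noteq> 1"
    by transfer (simp add: residue_rel_def)
qed

end

instantiation residue_field :: (valuation_ring) field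
begin

definition inverse_residue_field :: "'a residue_field \<Rightarrow> 'a residue_field" where
  "inverse_residue_field x = (if x = 0 then 0 else (THE y. x * y = 1))"

definition divide_residue_field :: "'a residue_field \<Rightarrow> 'a residue_field \<Rightarrow> 'a residue_field" where
  "divide_residue_field x y = x * inverse y"

instance
proof
  fix x y :: "'a residue_field"
  show "inverse (0 :: 'a residue_field) = 0"
    by (simp add: inverse_residue_field_def)
  show "x div y = x * inverse y"
    by (simp add: divide_residue_field_def)
  assume "x \<noteq> 0"
  then have "\<exists>y. x * y = 1"
  proof (transfer)
    fix x :: 'a
    assume "\<not> residue_rel x 0"
    then obtain y where "x * y = 1"
      by (auto simp: residue_rel_def elim!: dvdE)
    then show "\<exists>y. residue_rel (x * y) 1"
      by (auto simp: residue_rel_def intro!: exI[of _ y])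
  qed
  then obtain y where y: "x * y = 1" ..
  have "(THE y. x * y = 1) = y"
  proof (rule the_equality, rule y)
    fix z
    assume "x * z = 1"
    then have "y = (x * z) * y" by simp
    also have "\<dots> = z * (x * y)" by (simp only: ac_simps)
    also have "\<dots> = z" by (simp add: y)
    finally show "z = y" ..
  qed
  with y \<open>x \<noteq> 0\<close> show "inverse x * x = 1"
    by (simp add: inverse_residue_field_def mult.commute)
qed

end


section \<open>Complete valuation rings\<close>

definition fract_units :: "'r :: idom itself \<Rightarrow> 'r fract monoid" where
  "fract_units _ = \<lparr>carrier = UNIV - {0}, monoid.mult = (*), one = 1\<rparr>"

definition ring_units :: "'r :: idom fract set" where
  "ring_units = to_fract ` {u :: 'r. u dvd 1}"

definition value_group :: "'r :: idom itself \<Rightarrow> 'r fract set monoid" where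
  "value_group T = fract_units T Mod ring_units"

text \<open>
  The order on cosets is the multiplicative one: the class of \<open>x\<close> lies below that of \<open>y\<close> iff
  \<open>x / y\<close> belongs to the ring. It is the order for which passing to the norm is increasing.
\<close>

definition value_le :: "'r :: idom fract set \<Rightarrow> 'r fract set \<Rightarrow> bool" where
  "value_le A B \<longleftrightarrow> (\<exists>x\<in>A. \<exists>y\<in>B. x / y \<in> range to_fract)"

definition real_additive :: "real monoid" where
  "real_additive = \<lparr>carrier = UNIV, monoid.mult = (+), one = 0\<rparr>"

definition value_group_iso :: "('r :: idom fract set \<Rightarrow> real) \<Rightarrow> real set \<Rightarrow> bool" where
  "value_group_iso \<phi> H \<longleftrightarrow>
     subgroup H real_additive \<and>
     \<phi> \<in> iso (value_group TYPE('r)) (real_additive\<lparr>carrier := H\<rparr>) \<and>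
     (\<forall>A\<in>carrier (value_group TYPE('r)). \<forall>B\<in>carrier (value_group TYPE('r)).
        value_le A B \<longleftrightarrow> \<phi> A \<le> \<phi> B)"

text \<open>
  The base of the exponential is immaterial: rescaling \<open>\<phi>\<close> by a positive constant replaces the
  norm by the corresponding power.
\<close>

definition induced_norm :: "('r :: idom fract set \<Rightarrow> real) \<Rightarrow> 'r fract \<Rightarrow> real" where
  "induced_norm \<phi> x =
     (if x = 0 then 0 else exp (\<phi> (ring_units #>\<^bsub>fract_units TYPE('r)\<^esub> x)))"

text \<open>
  The ring \<open>'r\<close> is a complete valuation ring, and \<open>nrm\<close> is the norm on its fraction field
  induced by some embedding of the value group into the reals.
\<close>

definition complete_valuation_ring :: "('r :: valuation_ring fract \<Rightarrow> real) \<Rightarrow> bool" where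
  "complete_valuation_ring nrm \<longleftrightarrow>
     (\<exists>\<phi> H. value_group_iso \<phi> H \<and> nrm = induced_norm \<phi>) \<and>
     Metric_space.mcomplete (UNIV :: 'r set) (\<lambda>a b. nrm (to_fract (a - b)))"


section \<open>The affine line over a normed ring\<close>

definition multiplicative_seminorm :: "('a :: comm_ring_1 \<Rightarrow> real) \<Rightarrow> bool" where
  "multiplicative_seminorm s \<longleftrightarrow>
     (\<forall>x. 0 \<le> s x) \<and> s 0 = 0 \<and>
     (\<forall>x y. s (x + y) \<le> s x + s y) \<and>
     (\<forall>x y. s (x * y) = s x * s y)"

definition affine_line :: "('s :: comm_ring_1 \<Rightarrow> real) \<Rightarrow> ('s poly \<Rightarrow> real) set" where
  "affine_line N =
     {s. multiplicative_seminorm s \<and> s \<noteq> (\<lambda>_. 0) \<and> (\<forall>a. s [:a:] \<le> N a)}"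

definition trivial_norm :: "'a :: field \<Rightarrow> real" where
  "trivial_norm x = (if x = 0 then 0 else 1)"

definition Q_affine ::
  "('r :: valuation_ring residue_field poly \<Rightarrow> real) \<Rightarrow> ('r poly \<Rightarrow> real)" where
  "Q_affine \<mu> = \<mu> \<circ> map_poly to_residue"

text \<open>
  Restriction of seminorms along the inclusion of polynomial rings. The parameter \<open>\<omega>\<close> of
  \<open>J\<^sub>\<omega>\<close> only enters through its domain, the affine line over the field normed by \<open>nrm\<^sup>\<omega>\<close>.
\<close>

definition J_affine :: "('r :: idom fract poly \<Rightarrow> real) \<Rightarrow> ('r poly \<Rightarrow> real)" where
  "J_affine s = s \<circ> map_poly to_fract"

end

theory Submission
  imports Defs
begin

text \<open>
  Let \<open>\<lambda>\<close> be a point of the affine line over \<open>R\<close>. Its restriction \<open>w\<close> to the constants is a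
  multiplicative seminorm on \<open>R\<close> bounded by the norm, and everything depends on whether the prime
  ideal \<open>{a. w a = 0}\<close> is zero. The value group has rank one, so the only possibilities for this
  ideal are \<open>0\<close> and the maximal ideal of \<open>R\<close>.

  If \<open>w a = 0\<close> for some \<open>a \<noteq> 0\<close>, then every non-unit \<open>m\<close> has a power that is divisible by \<open>a\<close>,
  whence \<open>w m = 0\<close> (\<open>seminorm_nonunit_eq_0\<close>). Thus \<open>\<lambda>\<close> vanishes on the kernel of
  \<open>R[t] \<rightarrow> F[t]\<close> and descends to \<open>F[t]\<close> (\<open>multiplicative_seminorm_descends\<close>).

  If \<open>w\<close> vanishes only at \<open>0\<close>, then \<open>\<lambda>\<close> extends to \<open>K[t]\<close>, which is \<open>R[t]\<close> with the non-zero
  constants inverted (\<open>multiplicative_seminorm_extends\<close>). The bound \<open>w \<le> 1\<close> makes \<open>w\<close> monotone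
  for divisibility, that is, \<open>w\<close> is an order preserving function of the norm. An order preserving
  homomorphism between groups of real numbers is a scaling, so \<open>w\<close> is a power of the norm with
  some exponent \<open>\<omega>\<close>, and \<open>w \<le> nrm < 1\<close> at a non-zero non-unit forces \<open>\<omega> \<ge> 1\<close>
  (\<open>seminorm_eq_powr\<close>).

  Conversely, both kinds of points restrict to contractive seminorms: norms of elements of \<open>R\<close>
  are at most \<open>1\<close>, and equal to \<open>1\<close> exactly at the units.
\<close>

section \<open>Multiplicative seminorms along ring homomorphisms\<close>

lemma multiplicative_seminormD:
  assumes "multiplicative_seminorm s"
  shows "0 \<le> s x" "s 0 = 0" "s (x + y) \<le> s x + s y" "s (x * y) = s x * s y"
  using assms by (auto simp: multiplicative_seminorm_def)

lemma multiplicative_seminorm_one: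
  assumes "multiplicative_seminorm s" "s \<noteq> (\<lambda>_. 0)"
  shows "s 1 = 1"
proof -
  from assms(2) obtain x where "s x \<noteq> 0" by auto
  moreover have "s x = s x * s 1"
    using multiplicative_seminormD(4)[OF assms(1), of x 1] by simp
  ultimately show ?thesis by simp
qed

lemma multiplicative_seminorm_minus:
  assumes s: "multiplicative_seminorm s"
  shows "s (- x) = s x"
proof (cases "s = (\<lambda>_. 0)")
  case False
  have "s (- 1) * s (- 1) = 1"
    using multiplicative_seminormD(4)[OF s, of "- 1" "- 1"] multiplicative_seminorm_one[OF s False]
    by simp
  then have "s (- 1) = 1"
    using multiplicative_seminormD(1)[OF s, of "- 1"] by (simp add: square_eq_1_iff)
  then show ?thesis
    using multiplicative_seminormD(4)[OF s, of "- 1" x] by simp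
qed auto

lemma multiplicative_seminorm_power:
  assumes "multiplicative_seminorm s" "s 1 = 1"
  shows "s (x ^ n) = s x ^ n"
  using assms by (induction n) (simp_all add: multiplicative_seminormD(4))

lemma multiplicative_seminorm_eq_if_diff_eq_0:
  assumes s: "multiplicative_seminorm s" and "s (x - y) = 0"
  shows "s x = s y"
proof (rule antisym)
  show "s x \<le> s y"
    using multiplicative_seminormD(3)[OF s, of "x - y" y] assms(2) by simp
  have "s (y - x) = 0"
    using multiplicative_seminorm_minus[OF s, of "x - y"] assms(2) by simp
  then show "s y \<le> s x"
    using multiplicative_seminormD(3)[OF s, of "y - x" x] by simp
qed

lemma multiplicative_seminorm_comp:
  fixes h :: "'a :: comm_ring_1 \<Rightarrow> 'b :: comm_ring_1"
  assumes s: "multiplicative_seminorm s"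
    and add: "\<And>x y. h (x + y) = h x + h y" and mult: "\<And>x y. h (x * y) = h x * h y"
  shows "multiplicative_seminorm (s \<circ> h)"
proof -
  have "h 0 = 0" using add[of 0 0] by simp
  then show ?thesis
    using multiplicative_seminormD[OF s]
    by (simp add: multiplicative_seminorm_def add mult)
qed

lemma multiplicative_seminorm_descends:
  fixes h :: "'a :: comm_ring_1 \<Rightarrow> 'b :: comm_ring_1"
  assumes s: "multiplicative_seminorm s"
    and add: "\<And>x y. h (x + y) = h x + h y" and mult: "\<And>x y. h (x * y) = h x * h y"
    and surj: "surj h"
    and ker: "\<And>x. h x = 0 \<Longrightarrow> s x = 0"
  obtains \<mu> where "multiplicative_seminorm \<mu>" "s = \<mu> \<circ> h"
proof -
  have fibre: "s x = s y" if "h x = h y" for x y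
  proof (rule multiplicative_seminorm_eq_if_diff_eq_0[OF s], rule ker)
    have "h x = h (x - y) + h y" using add[of "x - y" y] by simp
    with that show "h (x - y) = 0" by simp
  qed
  define \<mu> where "\<mu> = s \<circ> inv_into UNIV h"
  have \<mu>_h: "\<mu> (h x) = s x" for x
    unfolding \<mu>_def comp_def by (rule fibre) (rule surj_f_inv_f[OF surj])
  have h0: "h 0 = 0" using add[of 0 0] by simp
  have "multiplicative_seminorm \<mu>"
    unfolding multiplicative_seminorm_def
  proof (intro conjI allI)
    show "\<mu> 0 = 0" using \<mu>_h[of 0] h0 multiplicative_seminormD(2)[OF s] by simp
    fix x' y' :: 'b
    obtain x y where [simp]: "x' = h x" "y' = h y" using surj by (metis surjD)
    show "0 \<le> \<mu> x'" by (simp add: \<mu>_h multiplicative_seminormD(1)[OF s])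
    show "\<mu> (x' + y') \<le> \<mu> x' + \<mu> y'"
      using multiplicative_seminormD(3)[OF s, of x y] by (simp add: \<mu>_h flip: add)
    show "\<mu> (x' * y') = \<mu> x' * \<mu> y'"
      using multiplicative_seminormD(4)[OF s, of x y] by (simp add: \<mu>_h flip: mult)
  qed
  then show thesis using \<mu>_h by (intro that[of \<mu>]) (auto simp: fun_eq_iff)
qed

text \<open>
  The hypothesis on denominators says that every element of the target is a fraction \<open>a / b\<close> with
  \<open>s b \<noteq> 0\<close>. The value of the extension there has to be \<open>s a / s b\<close>; multiplicativity of \<open>s\<close>
  makes this independent of the fraction, and a common denominator gives the triangle inequality.
\<close>

lemma multiplicative_seminorm_extends:
  fixes h :: "'a :: comm_ring_1 \<Rightarrow> 'b :: comm_ring_1"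
  assumes s: "multiplicative_seminorm s" and s1: "s 1 = 1"
    and add: "\<And>x y. h (x + y) = h x + h y" and mult: "\<And>x y. h (x * y) = h x * h y"
    and h1: "h 1 = 1" and inj: "inj h"
    and denom: "\<And>y. \<exists>a b. s b \<noteq> 0 \<and> h b * y = h a"
  obtains t where "multiplicative_seminorm t" "s = t \<circ> h"
    "\<And>a b y. s b \<noteq> 0 \<Longrightarrow> h b * y = h a \<Longrightarrow> t y = s a / s b"
proof -
  note sD = multiplicative_seminormD[OF s]
  define t where "t y = (THE r. \<exists>a b. s b \<noteq> 0 \<and> h b * y = h a \<and> r = s a / s b)" for y
  have t: "t y = s a / s b" if b: "s b \<noteq> 0" and ab: "h b * y = h a" for a b y
    unfolding t_def
  proof (rule the_equality)
    show "\<exists>a' b'. s b' \<noteq> 0 \<and> h b' * y = h a' \<and> s a / s b = s a' / s b'" using that by blast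
    fix r assume "\<exists>a b. s b \<noteq> 0 \<and> h b * y = h a \<and> r = s a / s b"
    then obtain a' b' where b': "s b' \<noteq> 0" and ab': "h b' * y = h a'" and r: "r = s a' / s b'"
      by blast
    have "h (b * a') = h b * (h b' * y)" by (simp only: mult ab')
    also have "\<dots> = h b' * (h b * y)" by (simp only: ac_simps)
    also have "\<dots> = h (b' * a)" by (simp only: mult ab)
    finally have "b * a' = b' * a" by (rule injD[OF inj])
    then have "s b * s a' = s b' * s a" by (simp flip: sD(4))
    with b b' show "r = s a / s b" by (simp add: r field_simps)
  qed
  have h0: "h 0 = 0" using add[of 0 0] by simp
  have t_h: "t (h x) = s x" for x
    using t[of 1 "h x" x] by (simp add: s1 h1)
  have "multiplicative_seminorm t"
    unfolding multiplicative_seminorm_def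
  proof (intro conjI allI)
    show "t 0 = 0" using t_h[of 0] by (simp add: h0 sD(2))
    fix x y :: 'b
    obtain a b where b: "s b \<noteq> 0" and ab: "h b * x = h a" using denom[of x] by blast
    obtain c d where d: "s d \<noteq> 0" and cd: "h d * y = h c" using denom[of y] by blast
    have bd: "s (b * d) \<noteq> 0" using b d by (simp add: sD(4))
    have tx: "t x = s a / s b" and ty: "t y = s c / s d"
      using t[OF b ab] t[OF d cd] .
    show "0 \<le> t x" by (simp add: tx sD(1))
    have "h (b * d) * (x * y) = (h b * x) * (h d * y)" by (simp only: mult ac_simps)
    also have "\<dots> = h (a * c)" by (simp only: ab cd mult)
    finally show "t (x * y) = t x * t y"
      using t[OF bd] by (simp add: tx ty sD(4))
    have "h (b * d) * (x + y) = h d * (h b * x) + h b * (h d * y)"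
      by (simp add: mult algebra_simps)
    also have "\<dots> = h (d * a + b * c)" by (simp only: ab cd mult add)
    finally have "t (x + y) = s (d * a + b * c) / s (b * d)" by (rule t[OF bd])
    also have "\<dots> \<le> (s d * s a + s b * s c) / s (b * d)"
      using sD(3)[of "d * a" "b * c"] by (intro divide_right_mono sD(1)) (simp add: sD(4))
    also have "\<dots> = t x + t y" using b d by (simp add: tx ty sD(4) field_simps)
    finally show "t (x + y) \<le> t x + t y" .
  qed
  moreover have "s = t \<circ> h" by (simp add: fun_eq_iff t_h)
  ultimately show thesis using t by (rule that)
qed

lemma multiplicative_seminorm_const_poly:
  assumes "multiplicative_seminorm (s :: 'a :: comm_ring_1 poly \<Rightarrow> real)"
  shows "multiplicative_seminorm (\<lambda>a. s [:a:])"
proof -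
  have "multiplicative_seminorm (s \<circ> (\<lambda>a. [:a:]))"
    by (rule multiplicative_seminorm_comp[OF assms]) simp_all
  then show ?thesis by (simp add: comp_def)
qed

text \<open>A seminorm that vanishes on an ideal of constants vanishes on the ideal it generates.\<close>

lemma multiplicative_seminorm_poly_eq_0:
  fixes s :: "'a :: comm_ring_1 poly \<Rightarrow> real"
  assumes s: "multiplicative_seminorm s" and coeffs: "\<And>n. s [:coeff p n:] = 0"
  shows "s p = 0"
  using coeffs
proof (induction p)
  case 0
  then show ?case by (simp add: multiplicative_seminormD(2)[OF s])
next
  case (pCons a p)
  have "s p = 0"
  proof (rule pCons.IH)
    show "s [:coeff p n:] = 0" for n using pCons.prems[of "Suc n"] by simp
  qed
  have "s (pCons a p) = s ([:a:] + [:0, 1:] * p)" by simp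
  also have "\<dots> \<le> s [:a:] + s [:0, 1:] * s p"
    using multiplicative_seminormD(3)[OF s, of "[:a:]" "[:0, 1:] * p"]
    by (simp only: multiplicative_seminormD(4)[OF s])
  also have "\<dots> = 0" using pCons.prems[of 0] \<open>s p = 0\<close> by simp
  finally show ?case using multiplicative_seminormD(1)[OF s, of "pCons a p"] by simp
qed

section \<open>The norm of a rank one valuation\<close>

lemma to_fract_power: "to_fract (a ^ n) = to_fract a ^ n"
  by (induction n) simp_all

text \<open>
  The last condition encodes that the ring is the closed unit ball, in the form in which it is
  inherited from an order isomorphism of the value group with a group of real numbers.
\<close>

locale valuation_norm =
  fixes nrm :: "'r :: valuation_ring fract \<Rightarrow> real"
  assumes nrm_0: "nrm 0 = 0"
    and nrm_pos: "x \<noteq> 0 \<Longrightarrow> 0 < nrm x"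
    and nrm_mult: "nrm (x * y) = nrm x * nrm y"
    and nrm_le_iff: "y \<noteq> 0 \<Longrightarrow> nrm x \<le> nrm y \<longleftrightarrow> x / y \<in> range to_fract"

lemma comm_group_fract_units: "comm_group (fract_units TYPE('r :: idom))"
proof (rule comm_groupI)
  fix x assume "x \<in> carrier (fract_units TYPE('r))"
  then show "\<exists>y\<in>carrier (fract_units TYPE('r)). y \<otimes>\<^bsub>fract_units TYPE('r)\<^esub> x = \<one>\<^bsub>fract_units TYPE('r)\<^esub>"
    by (intro bexI[of _ "inverse x"]) (auto simp: fract_units_def)
qed (auto simp: fract_units_def ac_simps)

lemma subgroup_ring_units: "subgroup (ring_units :: 'r :: idom fract set) (fract_units TYPE('r))"
proof -
  interpret comm_group "fract_units TYPE('r)" by (rule comm_group_fract_units)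
  show ?thesis
  proof (rule subgroupI)
    show "(ring_units :: 'r fract set) \<subseteq> carrier (fract_units TYPE('r))"
      by (auto simp: ring_units_def fract_units_def)
    show "(ring_units :: 'r fract set) \<noteq> {}" by (auto simp: ring_units_def intro: exI[of _ 1])
  next
    fix x :: "'r fract" assume "x \<in> ring_units"
    then obtain u v :: 'r where x: "x = to_fract u" and uv: "1 = u * v"
      by (auto simp: ring_units_def elim!: dvdE)
    have xv: "to_fract v * x = 1" "x * to_fract v = 1"
      using arg_cong[OF uv, of to_fract] by (simp_all add: x mult.commute)
    then have "x \<noteq> 0" "to_fract v \<noteq> 0" by auto
    with xv have "inv\<^bsub>fract_units TYPE('r)\<^esub> x = to_fract v"
      by (intro inv_equality) (simp_all add: fract_units_def)
    moreover have "v dvd 1" using uv by (metis dvd_triv_right)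
    ultimately show "inv\<^bsub>fract_units TYPE('r)\<^esub> x \<in> ring_units"
      by (auto simp: ring_units_def)
  next
    fix x y :: "'r fract" assume "x \<in> ring_units" "y \<in> ring_units"
    then obtain u v :: 'r where "x = to_fract u" "y = to_fract v" "u dvd 1" "v dvd 1"
      by (auto simp: ring_units_def)
    then have "x * y = to_fract (u * v)" "u * v dvd 1"
      using mult_dvd_mono[of u 1 v 1] by auto
    then have "x * y \<in> ring_units" unfolding ring_units_def by blast
    then show "x \<otimes>\<^bsub>fract_units TYPE('r)\<^esub> y \<in> ring_units"
      by (simp add: fract_units_def)
  qed
qed

text \<open>The order on cosets does not depend on representatives, because units can be moved into the
  quotient \<open>c\<close>.\<close>

lemma value_le_cosets_iff:
  fixes x y :: "'r :: idom fract"
  assumes "x \<noteq> 0" "y \<noteq> 0"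
  shows "value_le (ring_units #>\<^bsub>fract_units TYPE('r)\<^esub> x) (ring_units #>\<^bsub>fract_units TYPE('r)\<^esub> y)
    \<longleftrightarrow> x / y \<in> range to_fract"
proof
  assume "value_le (ring_units #>\<^bsub>fract_units TYPE('r)\<^esub> x) (ring_units #>\<^bsub>fract_units TYPE('r)\<^esub> y)"
  then obtain u v c :: 'r where u: "u dvd 1" and v: "v dvd 1"
    and c: "(to_fract u * x) / (to_fract v * y) = to_fract c"
    by (auto simp: value_le_def r_coset_def fract_units_def ring_units_def)
  obtain u' where u': "1 = u * u'" using u by (elim dvdE)
  have uu: "to_fract u * to_fract u' = 1" using arg_cong[OF u', of to_fract] by simp
  have "v \<noteq> 0" using v by auto
  then have "to_fract u * x = to_fract c * (to_fract v * y)"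
    using c assms(2) by (simp add: nonzero_divide_eq_eq)
  then have "to_fract u' * (to_fract u * x) = to_fract u' * (to_fract c * (to_fract v * y))"
    by simp
  then have "(to_fract u * to_fract u') * x = to_fract (u' * c * v) * y"
    by (simp add: ac_simps)
  then have "x / y = to_fract (u' * c * v)" using assms(2) uu by simp
  then show "x / y \<in> range to_fract" by blast
next
  interpret comm_group "fract_units TYPE('r)" by (rule comm_group_fract_units)
  have "z \<in> ring_units #>\<^bsub>fract_units TYPE('r)\<^esub> z" if "z \<noteq> 0" for z :: "'r fract"
    using that by (intro rcos_self subgroup_ring_units) (simp add: fract_units_def)
  moreover assume "x / y \<in> range to_fract"
  ultimately show "value_le (ring_units #>\<^bsub>fract_units TYPE('r)\<^esub> x)
      (ring_units #>\<^bsub>fract_units TYPE('r)\<^esub> y)"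
    using assms by (auto simp: value_le_def)
qed

lemma valuation_norm_induced_norm:
  fixes \<phi> :: "'r :: valuation_ring fract set \<Rightarrow> real"
  assumes "value_group_iso \<phi> H"
  shows "valuation_norm (induced_norm \<phi>)"
proof -
  interpret comm_group "fract_units TYPE('r)" by (rule comm_group_fract_units)
  interpret normal ring_units "fract_units TYPE('r)"
    by (rule subgroup_imp_normal) (rule subgroup_ring_units)
  define cs where "cs x = ring_units #>\<^bsub>fract_units TYPE('r)\<^esub> x" for x :: "'r fract"
  have cs_mem: "cs x \<in> carrier (value_group TYPE('r))" if "x \<noteq> 0" for x
    using that by (auto simp: cs_def value_group_def carrier_FactGroup fract_units_def)
  have \<phi>_hom: "\<phi> \<in> hom (value_group TYPE('r)) (real_additive\<lparr>carrier := H\<rparr>)"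
    and le: "value_le A B \<longleftrightarrow> \<phi> A \<le> \<phi> B"
      if "A \<in> carrier (value_group TYPE('r))" "B \<in> carrier (value_group TYPE('r))" for A B
    using assms that by (auto simp: value_group_iso_def iso_def)
  have cs_mult: "\<phi> (cs (x * y)) = \<phi> (cs x) + \<phi> (cs y)" if "x \<noteq> 0" "y \<noteq> 0" for x y
  proof -
    have "cs (x * y) = cs x \<otimes>\<^bsub>value_group TYPE('r)\<^esub> cs y"
      using that rcos_sum[of x y] by (simp add: cs_def value_group_def fract_units_def)
    then show ?thesis
      using hom_mult[OF \<phi>_hom[OF cs_mem[OF that(1)] cs_mem[OF that(2)]]
          cs_mem[OF that(1)] cs_mem[OF that(2)]]
      by (simp add: real_additive_def)
  qed
  have nrm: "induced_norm \<phi> x = (if x = 0 then 0 else exp (\<phi> (cs x)))" for x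
    by (simp add: induced_norm_def cs_def)
  show ?thesis
  proof
    fix x y :: "'r fract"
    show "induced_norm \<phi> 0 = 0" by (simp add: nrm)
    show "0 < induced_norm \<phi> x" if "x \<noteq> 0" using that by (simp add: nrm)
    show "induced_norm \<phi> (x * y) = induced_norm \<phi> x * induced_norm \<phi> y"
      by (simp add: nrm cs_mult exp_add)
    show "induced_norm \<phi> x \<le> induced_norm \<phi> y \<longleftrightarrow> x / y \<in> range to_fract" if y: "y \<noteq> 0"
    proof (cases "x = 0")
      case True
      then show ?thesis using y by (auto simp: nrm intro: image_eqI[of _ _ 0])
    next
      case False
      then show ?thesis
        using le[OF cs_mem[OF False] cs_mem[OF y]] value_le_cosets_iff[OF False y] y
        by (simp add: nrm cs_def)
    qed
  qed
qed

context valuation_norm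
begin

lemma nrm_1: "nrm 1 = 1"
  using nrm_mult[of 1 1] nrm_pos[of 1] by simp

lemma nrm_nonneg: "0 \<le> nrm x"
  using nrm_pos[of x] by (cases "x = 0") (auto simp: nrm_0)

lemma nrm_power: "nrm (x ^ n) = nrm x ^ n"
  by (induction n) (simp_all add: nrm_1 nrm_mult)

lemma nrm_to_fract_le_iff:
  assumes "b \<noteq> 0"
  shows "nrm (to_fract a) \<le> nrm (to_fract b) \<longleftrightarrow> b dvd a"
proof -
  have "to_fract a / to_fract b = to_fract c \<longleftrightarrow> a = b * c" for c
  proof -
    have "to_fract a / to_fract b = to_fract c \<longleftrightarrow> to_fract a = to_fract (b * c)"
      using assms by (simp add: nonzero_divide_eq_eq mult.commute)
    then show ?thesis by (simp only: to_fract_eq_iff)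
  qed
  then show ?thesis
    using nrm_le_iff[of "to_fract b" "to_fract a"] assms by (auto simp: dvd_def)
qed

lemma nrm_to_fract_le_1: "nrm (to_fract a) \<le> 1"
  using nrm_to_fract_le_iff[of 1 a] by (simp add: nrm_1)

lemma nrm_to_fract_less_1_iff: "nrm (to_fract a) < 1 \<longleftrightarrow> \<not> a dvd 1"
proof (cases "a = 0")
  case False
  then show ?thesis using nrm_to_fract_le_iff[of a 1] by (auto simp: nrm_1 not_le[symmetric])
qed (simp add: nrm_0)

section \<open>Contractive multiplicative seminorms on the ring\<close>

text \<open>The norms of the powers of a non-unit tend to \<open>0\<close>, so \<open>a\<close> divides one of these powers.\<close>

lemma seminorm_nonunit_eq_0:
  fixes w :: "'r \<Rightarrow> real"
  assumes w: "multiplicative_seminorm w" "w 1 = 1"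
    and "w a = 0" "a \<noteq> 0" "\<not> m dvd 1"
  shows "w m = 0"
proof -
  have "nrm (to_fract m) < 1" using assms by (simp add: nrm_to_fract_less_1_iff)
  moreover have "0 < nrm (to_fract a)" using assms by (intro nrm_pos) simp
  ultimately obtain n where "nrm (to_fract m) ^ n < nrm (to_fract a)"
    using real_arch_pow_inv by blast
  then have "nrm (to_fract (m ^ n)) \<le> nrm (to_fract a)"
    by (simp add: to_fract_power nrm_power)
  then obtain c where "m ^ n = a * c"
    using nrm_to_fract_le_iff[OF \<open>a \<noteq> 0\<close>] by (auto elim: dvdE)
  then have "w m ^ n = w a * w c"
    by (metis multiplicative_seminorm_power[OF w] multiplicative_seminormD(4)[OF w(1)])
  with \<open>w a = 0\<close> show ?thesis by simp
qed

end

text \<open>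
  This is the Archimedean argument behind the rigidity of ordered subgroups of the reals: an
  order relation between all multiples of \<open>x\<close> and \<open>y\<close> determines their ratio.
\<close>

lemma ratio_le_if_multiples_le:
  fixes x y x' y' :: real
  assumes "0 \<le> x" "0 < y" "0 \<le> y'"
    and mono: "\<And>(p :: nat) (q :: nat). p * x \<le> q * y \<Longrightarrow> p * x' \<le> q * y'"
  shows "x' * y \<le> x * y'"
proof (rule ccontr)
  assume "\<not> x' * y \<le> x * y'"
  then have "0 < x' * y - x * y'" by simp
  then obtain n :: nat where n: "y' * y < n * (x' * y - x * y')"
    using reals_Archimedean3 by blast
  \<comment> \<open>The multiple \<open>q * y\<close> exceeds \<open>n * x\<close> by at most \<open>y\<close>, an error that does not grow with \<open>n\<close>.\<close>
  define q where "q = nat \<lceil>n * x / y\<rceil>"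
  have q: "real q - 1 \<le> n * x / y" "n * x / y \<le> q"
    using assms(1,2) by (auto simp: q_def)
  have "n * x' \<le> q * y'"
    using q(2) assms(2) by (intro mono) (simp add: field_simps)
  also have "\<dots> \<le> (n * x / y + 1) * y'"
    using q(1) assms(3) by (intro mult_right_mono) auto
  finally have "n * x' * y \<le> (n * x / y + 1) * y' * y"
    using assms(2) by (intro mult_right_mono) auto
  also have "\<dots> = n * x * y' + y' * y" using assms(2) by (simp add: field_simps)
  finally show False using n by (simp add: algebra_simps)
qed

context valuation_norm
begin

text \<open>
  The inequality between powers \<open>nrm b ^ q \<le> nrm a ^ p\<close> means that \<open>a ^ p\<close> divides \<open>b ^ q\<close>, and a
  seminorm bounded by \<open>1\<close> can only decrease from a divisor to a multiple. So the comparisons between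
  multiples of \<open>- ln (nrm a)\<close> and \<open>- ln (nrm b)\<close> carry over to \<open>w\<close>.
\<close>

lemma seminorm_log_ratio_le:
  fixes w :: "'r \<Rightarrow> real"
  assumes w: "multiplicative_seminorm w" "w 1 = 1" and w_le: "\<And>a. w a \<le> nrm (to_fract a)"
    and w_pos: "\<And>a. a \<noteq> 0 \<Longrightarrow> 0 < w a"
    and a: "a \<noteq> 0" and b: "b \<noteq> 0" "\<not> b dvd 1"
  shows "ln (w a) * ln (nrm (to_fract b)) \<le> ln (nrm (to_fract a)) * ln (w b)"
proof -
  have n_pos: "0 < nrm (to_fract c)" if "c \<noteq> 0" for c using that by (intro nrm_pos) simp
  have "- ln (w a) * - ln (nrm (to_fract b)) \<le> - ln (nrm (to_fract a)) * - ln (w b)"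
  proof (rule ratio_le_if_multiples_le)
    show "0 \<le> - ln (nrm (to_fract a))"
      using nrm_to_fract_le_1[of a] n_pos[OF a] by (simp add: ln_le_zero_iff)
    show "0 < - ln (nrm (to_fract b))"
      using nrm_to_fract_less_1_iff[of b] b n_pos[OF b(1)] by simp
    show "0 \<le> - ln (w b)"
      using order_trans[OF w_le nrm_to_fract_le_1, of b] w_pos[OF b(1)] by (simp add: ln_le_zero_iff)
  next
    fix p q :: nat
    assume "real p * - ln (nrm (to_fract a)) \<le> real q * - ln (nrm (to_fract b))"
    then have "ln (nrm (to_fract (b ^ q))) \<le> ln (nrm (to_fract (a ^ p)))"
      using n_pos a b(1) by (simp add: to_fract_power nrm_power ln_realpow)
    then have "nrm (to_fract (b ^ q)) \<le> nrm (to_fract (a ^ p))"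
      using n_pos[of "b ^ q"] n_pos[of "a ^ p"] a b(1) by (subst (asm) ln_le_cancel_iff) auto
    then obtain c where "b ^ q = a ^ p * c"
      using nrm_to_fract_le_iff[of "a ^ p" "b ^ q"] a by (auto elim: dvdE)
    then have "w (b ^ q) = w (a ^ p) * w c" using multiplicative_seminormD(4)[OF w(1)] by simp
    moreover have "w c \<le> 1" using order_trans[OF w_le nrm_to_fract_le_1] .
    ultimately have "w b ^ q \<le> w a ^ p"
      using mult_left_mono[of "w c" 1 "w (a ^ p)"] multiplicative_seminormD(1)[OF w(1), of "a ^ p"]
      by (simp add: multiplicative_seminorm_power[OF w])
    then have "ln (w b ^ q) \<le> ln (w a ^ p)"
      using w_pos[OF a] w_pos[OF b(1)] by (subst ln_le_cancel_iff) auto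
    then show "real p * - ln (w a) \<le> real q * - ln (w b)"
      using w_pos[OF a] w_pos[OF b(1)] by (simp add: ln_realpow)
  qed
  then show ?thesis by simp
qed

text \<open>
  The ratio \<open>ln (w a) / ln (nrm a)\<close> is the same for all non-zero non-units, by the preceding
  inequality in both directions; it is read off at \<open>\<pi>\<close>. At units both logarithms vanish.
\<close>

lemma seminorm_eq_powr:
  fixes w :: "'r \<Rightarrow> real"
  assumes w: "multiplicative_seminorm w" "w 1 = 1" and w_le: "\<And>a. w a \<le> nrm (to_fract a)"
    and w_nz: "\<And>a. a \<noteq> 0 \<Longrightarrow> w a \<noteq> 0"
    and \<pi>: "\<pi> \<noteq> (0 :: 'r)" "\<not> \<pi> dvd 1"
  obtains \<omega> where "1 \<le> \<omega>" "\<And>a. w a = nrm (to_fract a) powr \<omega>"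
proof -
  have w_pos: "0 < w a" if "a \<noteq> 0" for a
    using multiplicative_seminormD(1)[OF w(1), of a] w_nz[OF that] by simp
  have n_pos: "0 < nrm (to_fract a)" if "a \<noteq> 0" for a using that by (intro nrm_pos) simp
  define \<omega> where "\<omega> = ln (w \<pi>) / ln (nrm (to_fract \<pi>))"
  have neg: "ln (nrm (to_fract \<pi>)) < 0"
    using nrm_to_fract_less_1_iff[of \<pi>] \<pi> n_pos by simp
  have "ln (w \<pi>) \<le> ln (nrm (to_fract \<pi>))"
    using w_le[of \<pi>] w_pos[OF \<pi>(1)] n_pos[OF \<pi>(1)] by simp
  then have "1 \<le> \<omega>" using neg by (simp add: \<omega>_def field_simps)
  moreover have "w a = nrm (to_fract a) powr \<omega>" for a
  proof (cases "a = 0")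
    case True
    then show ?thesis by (simp add: nrm_0 multiplicative_seminormD(2)[OF w(1)])
  next
    case a: False
    have "ln (w a) * ln (nrm (to_fract \<pi>)) = ln (nrm (to_fract a)) * ln (w \<pi>)"
    proof (cases "a dvd 1")
      case True
      then obtain b where b: "1 = a * b" by (elim dvdE)
      have "nrm (to_fract a) = 1"
        using True nrm_to_fract_less_1_iff[of a] nrm_to_fract_le_1[of a] by simp
      moreover have "w a = 1"
      proof -
        have le1: "w c \<le> 1" for c using order_trans[OF w_le nrm_to_fract_le_1] .
        have "1 = w a * w b" using w(2) by (simp add: b multiplicative_seminormD(4)[OF w(1)])
        also have "\<dots> \<le> w a * 1"
          using le1 multiplicative_seminormD(1)[OF w(1)] by (intro mult_left_mono)
        finally show ?thesis using le1[of a] by simp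
      qed
      ultimately show ?thesis by simp
    next
      case False
      from seminorm_log_ratio_le[OF w w_le w_pos a \<pi>] seminorm_log_ratio_le[OF w w_le w_pos \<pi>(1) a False]
      show ?thesis by (simp add: mult.commute)
    qed
    then have "ln (w a) = \<omega> * ln (nrm (to_fract a))"
      using neg by (simp add: \<omega>_def field_simps)
    then show ?thesis
      using w_pos[OF a] n_pos[OF a] by (simp add: powr_def) (metis exp_ln)
  qed
  ultimately show thesis by (rule that)
qed

end

section \<open>Passing to the residue field and to the fraction field\<close>

lemma to_residue_hom [simp]:
  "to_residue 0 = 0" "to_residue 1 = 1"
  "to_residue (a + b) = to_residue a + to_residue b"
  "to_residue (a * b) = to_residue a * to_residue b"
  by (simp_all add: zero_residue_field_def one_residue_field_def
      plus_residue_field.abs_eq times_residue_field.abs_eq)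

lemma to_residue_eq_0_iff: "to_residue a = 0 \<longleftrightarrow> \<not> a dvd 1"
proof -
  have "to_residue a = to_residue 0 \<longleftrightarrow> \<not> a dvd 1"
    by (simp only: residue_field.abs_eq_iff residue_rel_def diff_zero)
  then show ?thesis by simp
qed

lemma surj_to_residue: "surj to_residue"
  by (metis Quotient3_abs_rep Quotient3_residue_field surjI)

lemma to_residue_poly_add:
  "map_poly to_residue (p + q) = map_poly to_residue p + map_poly to_residue q"
  by (intro poly_eqI) (simp add: coeff_map_poly)

lemma to_residue_poly_mult:
  "map_poly to_residue (p * q) = map_poly to_residue p * map_poly to_residue q"
proof -
  have "to_residue (sum f A) = (\<Sum>i\<in>A. to_residue (f i))" for f :: "nat \<Rightarrow> 'a" and A
    by (induction A rule: infinite_finite_induct) simp_all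
  then show ?thesis by (intro poly_eqI) (simp add: coeff_map_poly coeff_mult)
qed

lemma surj_to_residue_poly: "surj (map_poly to_residue)"
proof -
  have "\<exists>p. q = map_poly to_residue p" for q :: "'a residue_field poly"
  proof (induction q)
    case 0
    show ?case by (rule exI[of _ 0]) simp
  next
    case (pCons c q)
    then obtain p where "q = map_poly to_residue p" by blast
    moreover obtain a where "c = to_residue a" using surj_to_residue by (metis surjD)
    ultimately have "pCons c q = map_poly to_residue (pCons a p)" by (simp add: map_poly_pCons)
    then show ?case by blast
  qed
  then show ?thesis by (auto simp: surj_def)
qed

text \<open>A product of denominators of the coefficients is a common denominator.\<close>

lemma fract_poly_common_denominator:
  fixes p :: "'r :: idom fract poly"
  obtains q b where "b \<noteq> 0" "map_poly to_fract [:b:] * p = map_poly to_fract q"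
proof -
  have "\<exists>q b. b \<noteq> 0 \<and> smult (to_fract b) p = map_poly to_fract q"
  proof (induction p)
    case 0
    show ?case by (intro exI[of _ 0] exI[of _ 1]) simp
  next
    case (pCons x p)
    then obtain q b where b: "b \<noteq> 0" and q: "smult (to_fract b) p = map_poly to_fract q" by blast
    obtain c d where x: "x = to_fract c / to_fract d" and d: "d \<noteq> 0"
      by (cases x) (auto simp: Fract_conv_to_fract)
    have "smult (to_fract (b * d)) (pCons x p) = pCons (to_fract (b * c)) (smult (to_fract d) (smult (to_fract b) p))"
      using d by (simp add: x mult.commute)
    also have "\<dots> = map_poly to_fract (pCons (b * c) (smult d q))"
      by (simp add: q map_poly_pCons)
    finally show ?case using b d by (metis mult_eq_0_iff)
  qed
  then obtain q b where "b \<noteq> 0" "smult (to_fract b) p = map_poly to_fract q" by blast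
  then show thesis by (intro that[of b q]) (simp_all add: map_poly_pCons)
qed

context valuation_norm
begin

text \<open>
  The trivial norm of a residue class is bounded by the norm of any representative, since it is
  \<open>1\<close> only for units, and these have norm \<open>1\<close>.
\<close>

lemma Q_affine_contractive:
  assumes "\<mu> \<in> affine_line (trivial_norm :: 'r residue_field \<Rightarrow> real)"
  shows "Q_affine \<mu> \<in> affine_line (\<lambda>a. nrm (to_fract a))"
proof -
  have \<mu>: "multiplicative_seminorm \<mu>" "\<mu> \<noteq> (\<lambda>_. 0)" "\<mu> [:c:] \<le> trivial_norm c" for c
    using assms by (auto simp: affine_line_def)
  have "multiplicative_seminorm (Q_affine \<mu>)"
    unfolding Q_affine_def
    by (rule multiplicative_seminorm_comp[OF \<mu>(1) to_residue_poly_add to_residue_poly_mult])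
  moreover have "Q_affine \<mu> 1 = 1"
    using multiplicative_seminorm_one[OF \<mu>(1,2)] by (simp add: Q_affine_def)
  then have "Q_affine \<mu> \<noteq> (\<lambda>_. 0)" by auto
  moreover have "Q_affine \<mu> [:a:] \<le> nrm (to_fract a)" for a
  proof -
    have "Q_affine \<mu> [:a:] \<le> trivial_norm (to_residue a)"
      using \<mu>(3) by (simp add: Q_affine_def map_poly_pCons)
    also have "\<dots> \<le> nrm (to_fract a)"
      using nrm_to_fract_less_1_iff[of a] nrm_nonneg[of "to_fract a"]
      by (auto simp: trivial_norm_def to_residue_eq_0_iff)
    finally show ?thesis .
  qed
  ultimately show ?thesis by (simp add: affine_line_def)
qed

text \<open>Raising to a power \<open>\<omega> \<ge> 1\<close> decreases norms of ring elements, as these lie in \<open>[0, 1]\<close>.\<close>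

lemma J_affine_contractive:
  assumes "1 \<le> \<omega>" "s \<in> affine_line (\<lambda>x. nrm x powr \<omega>)"
  shows "J_affine s \<in> affine_line (\<lambda>a. nrm (to_fract a))"
proof -
  have s: "multiplicative_seminorm s" "s \<noteq> (\<lambda>_. 0)" "s [:x:] \<le> nrm x powr \<omega>" for x
    using assms by (auto simp: affine_line_def)
  have "multiplicative_seminorm (J_affine s)"
    unfolding J_affine_def by (rule multiplicative_seminorm_comp[OF s(1)]) simp_all
  moreover have "J_affine s 1 = 1"
    using multiplicative_seminorm_one[OF s(1,2)] by (simp add: J_affine_def)
  then have "J_affine s \<noteq> (\<lambda>_. 0)" by auto
  moreover have "J_affine s [:a:] \<le> nrm (to_fract a)" for a
  proof -
    have "J_affine s [:a:] \<le> nrm (to_fract a) powr \<omega>"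
      using s(3) by (simp add: J_affine_def map_poly_pCons)
    also have "\<dots> \<le> nrm (to_fract a) powr 1"
      using assms(1) nrm_nonneg nrm_to_fract_le_1 by (intro powr_mono') auto
    finally show ?thesis using nrm_nonneg by simp
  qed
  ultimately show ?thesis by (simp add: affine_line_def)
qed

text \<open>
  One non-zero constant in the kernel forces the whole maximal ideal into it. The induced seminorm
  on \<open>F[t]\<close> is contractive because every representative of a non-zero class has norm at most \<open>1\<close>.
\<close>

lemma affine_line_in_Q_affine:
  assumes s: "s \<in> affine_line (\<lambda>a. nrm (to_fract a))" and a: "a \<noteq> 0" "s [:a:] = 0"
  shows "s \<in> Q_affine ` affine_line (trivial_norm :: 'r residue_field \<Rightarrow> real)"
proof -
  have sD: "multiplicative_seminorm s" "s \<noteq> (\<lambda>_. 0)" "s [:c:] \<le> nrm (to_fract c)" for c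
    using s by (auto simp: affine_line_def)
  have s1: "s [:1:] = 1" using multiplicative_seminorm_one[OF sD(1,2)] by (simp add: one_pCons)
  have max: "s [:m:] = 0" if "\<not> m dvd 1" for m
    using seminorm_nonunit_eq_0[OF multiplicative_seminorm_const_poly[OF sD(1)] s1 a(2,1) that] .
  have ker: "s p = 0" if "map_poly to_residue p = 0" for p
  proof (rule multiplicative_seminorm_poly_eq_0[OF sD(1)], rule max)
    fix n
    show "\<not> coeff p n dvd 1"
      using arg_cong[OF that, of "\<lambda>q. coeff q n"] by (simp add: coeff_map_poly to_residue_eq_0_iff)
  qed
  obtain \<mu> where \<mu>: "multiplicative_seminorm \<mu>" "s = \<mu> \<circ> map_poly to_residue"
    by (rule multiplicative_seminorm_descends[OF sD(1) to_residue_poly_add to_residue_poly_mult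
          surj_to_residue_poly ker])
  have "\<mu> [:c:] \<le> trivial_norm c" for c
  proof -
    obtain b where c: "c = to_residue b" using surj_to_residue by (metis surjD)
    have "\<mu> [:c:] = s [:b:]" by (simp add: \<mu>(2) c map_poly_pCons)
    moreover have "s [:b:] \<le> 1" using order_trans[OF sD(3) nrm_to_fract_le_1] .
    ultimately show ?thesis
      using max[of b] by (auto simp: trivial_norm_def c to_residue_eq_0_iff)
  qed
  moreover have "\<mu> \<noteq> (\<lambda>_. 0)" using sD(2) \<mu>(2) by auto
  ultimately have "\<mu> \<in> affine_line trivial_norm" using \<mu>(1) by (simp add: affine_line_def)
  then show ?thesis using \<mu>(2) by (auto simp: Q_affine_def)
qed

text \<open>
  The denominators needed to reach \<open>K[t]\<close> are non-zero constants, whose seminorm is non-zero. The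
  extension is contractive for the power of the norm because it equals that power on \<open>K\<close>.
\<close>

lemma affine_line_in_J_affine:
  assumes s: "s \<in> affine_line (\<lambda>a. nrm (to_fract a))"
    and nz: "\<And>a. a \<noteq> 0 \<Longrightarrow> s [:a:] \<noteq> 0"
    and \<pi>: "\<pi> \<noteq> (0 :: 'r)" "\<not> \<pi> dvd 1"
  obtains \<omega> where "1 \<le> \<omega>" "s \<in> J_affine ` affine_line (\<lambda>x. nrm x powr \<omega>)"
proof -
  have sD: "multiplicative_seminorm s" "s \<noteq> (\<lambda>_. 0)" "s [:c:] \<le> nrm (to_fract c)" for c
    using s by (auto simp: affine_line_def)
  have s1: "s 1 = 1" using multiplicative_seminorm_one[OF sD(1,2)] .
  then have s1': "s [:1:] = 1" by (simp add: one_pCons)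
  obtain \<omega> where \<omega>: "1 \<le> \<omega>" "\<And>a. s [:a:] = nrm (to_fract a) powr \<omega>"
    using seminorm_eq_powr[OF multiplicative_seminorm_const_poly[OF sD(1)] s1' sD(3) nz \<pi>] by blast
  have denom: "\<exists>q b. s b \<noteq> 0 \<and> map_poly to_fract b * p = map_poly to_fract q" for p
    by (rule fract_poly_common_denominator[of p]) (use nz in blast)
  have inj: "inj (map_poly to_fract :: 'r poly \<Rightarrow> _)" by (rule injI) simp
  obtain t where t: "multiplicative_seminorm t" "s = t \<circ> map_poly to_fract"
    "\<And>q b p. s b \<noteq> 0 \<Longrightarrow> map_poly to_fract b * p = map_poly to_fract q \<Longrightarrow> t p = s q / s b"
    using multiplicative_seminorm_extends[OF sD(1) s1 fract_poly_add fract_poly_mult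
        fract_poly_1 inj denom] by blast
  have "t [:x:] \<le> nrm x powr \<omega>" for x
  proof -
    obtain c d where x: "x = to_fract c / to_fract d" and d: "d \<noteq> 0"
      by (cases x) (auto simp: Fract_conv_to_fract)
    have "nrm x * nrm (to_fract d) = nrm (to_fract c)"
      using d by (simp add: x flip: nrm_mult)
    moreover have "0 < nrm (to_fract d)" using d by (intro nrm_pos) simp
    ultimately have "nrm x = nrm (to_fract c) / nrm (to_fract d)" by (simp add: field_simps)
    moreover have "t [:x:] = s [:c:] / s [:d:]"
      using d by (intro t(3) nz) (simp_all add: x map_poly_pCons)
    ultimately show ?thesis using nrm_nonneg by (simp add: \<omega>(2) powr_divide)
  qed
  moreover have "t \<noteq> (\<lambda>_. 0)" using sD(2) t(2) by auto
  ultimately have "t \<in> affine_line (\<lambda>x. nrm x powr \<omega>)" using t(1) by (simp add: affine_line_def)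
  then have "s \<in> J_affine ` affine_line (\<lambda>x. nrm x powr \<omega>)"
    using t(2) by (auto simp: J_affine_def)
  with \<omega>(1) show thesis by (rule that)
qed

end

section \<open>The decomposition of the affine line\<close>

theorem proposition2p4:
  fixes nrm :: "'r :: valuation_ring fract \<Rightarrow> real"
  assumes complete: "complete_valuation_ring nrm"
    and not_field: "\<exists>a :: 'r. a \<noteq> 0 \<and> \<not> a dvd 1"
  shows "affine_line (\<lambda>a. nrm (to_fract a)) =
           Q_affine ` affine_line (trivial_norm :: 'r residue_field \<Rightarrow> real) \<union>
           (\<Union>\<omega>\<in>{1..}. J_affine ` affine_line (\<lambda>x. nrm x powr \<omega>))"
proof -
  interpret valuation_norm nrm
    using complete valuation_norm_induced_norm by (auto simp: complete_valuation_ring_def)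
  obtain \<pi> :: 'r where \<pi>: "\<pi> \<noteq> 0" "\<not> \<pi> dvd 1" using not_field by blast
  show ?thesis
  proof (intro subset_antisym subsetI)
    fix s assume s: "s \<in> affine_line (\<lambda>a. nrm (to_fract a))"
    show "s \<in> Q_affine ` affine_line (trivial_norm :: 'r residue_field \<Rightarrow> real) \<union>
           (\<Union>\<omega>\<in>{1..}. J_affine ` affine_line (\<lambda>x. nrm x powr \<omega>))"
    proof (cases "\<exists>a. a \<noteq> 0 \<and> s [:a:] = 0")
      case True
      then show ?thesis using affine_line_in_Q_affine[OF s] by blast
    next
      case False
      then have nz: "s [:a:] \<noteq> 0" if "a \<noteq> 0" for a using that by blast
      obtain \<omega> where "1 \<le> \<omega>" "s \<in> J_affine ` affine_line (\<lambda>x. nrm x powr \<omega>)"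
        using affine_line_in_J_affine[OF s nz \<pi>] .
      then show ?thesis by auto
    qed
  next
    fix s assume "s \<in> Q_affine ` affine_line (trivial_norm :: 'r residue_field \<Rightarrow> real) \<union>
           (\<Union>\<omega>\<in>{1..}. J_affine ` affine_line (\<lambda>x. nrm x powr \<omega>))"
    then show "s \<in> affine_line (\<lambda>a. nrm (to_fract a))"
      by (elim UnE UN_E imageE) (simp_all add: Q_affine_contractive J_affine_contractive)
  qed
qed

end
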